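(* Let $\mathcal{C}\subset\mathbb{R}^2$ be a curve that is piecewise $C^1$ and has a piecewise bi-Lipschitz continuous unit tangent vector. Then there exists a constant $C>0$, depending on $\mathcal{C}$ but not on $n$, such that for all $n\in\mathbb{N}$, $$\mathrm{Fav}_{\mathcal{C}}(K_n)\ge C\,n^{-1},$$ where $K_n$ is the $n$-th generation of the four-corner Cantor set and $\mathrm{Fav}_{\mathcal{C}}$ is the Favard curve length.
   Context: Favard curve length: for a curve $\mathcal{C}\subset\mathbb{R}^2$, $\alpha\in\mathbb{R}$ and $p\in\mathbb{R}^2$, let $\Phi_\alpha(p)=\{\beta\in\mathbb{R}:(\alpha,\beta)\in p-\mathcal{C}\}$, where $p-\mathcal{C}=\{p-z:z\in\mathcal{C}\}$, and $\Phi_\alpha(E)=\bigcup_{p\in E}\Phi_\alpha(p)$. Also $\Phi_\alpha^{-1}(\beta)=\{p:\beta\in\Phi_\alpha(p)\}=(\alpha,\beta)+\mathcal{C}$. For $E\subset\mathbb{R}^2$, $$\mathrm{Fav}_{\mathcal{C}}(E)=\left|\{(\alpha,\beta)\in\mathbb{R}^2:((\alpha,\beta)+\mathcal{C})\cap E\neq\emptyset\}\right|=\int_{\mathbb{R}}|\Phi_\alpha(E)|\,d\alpha=|E-\mathcal{C}|,$$ where $|\cdot|$ is Lebesgue measure (of the appropriate dimension). Four-corner Cantor set: $C_0=[0,1]$ and for $n\ge 1$, $C_n=\bigcup_{a_1,\dots,a_n\in\{0,3\}}\left[\sum_{j=1}^n a_j4^{-j},\ \sum_{j=1}^n a_j4^{-j}+4^{-n}\right]$;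 $K_n=C_n\times C_n$. Curve class: "piecewise $C^1$ with a piecewise bi-Lipschitz continuous unit tangent vector" means that $\mathcal{C}$ can be written as a disjoint union of finitely many (nondegenerate) subcurves, each of which is $C^1$ with a unit tangent vector $T$ that is bi-Lipschitz along the subcurve (as a function of arclength $s$: there is $\lambda\ge 1$ with $\lambda^{-1}|s-t|\le|T(s)-T(t)|\le\lambda|s-t|$ for all $s,t$ in the parameter interval of that subcurve). *)

theory Defs
  imports "HOL-Analysis.Analysis"
begin

definition nondegenerate_interval :: "real set \<Rightarrow> bool" where
  "nondegenerate_interval I \<longleftrightarrow> is_interval I \<and> interior I \<noteq> {}"

definition curve :: "(real \<times> real) set \<Rightarrow> bool" where
  "curve S \<longleftrightarrow> (\<exists>I \<gamma>. nondegenerate_interval I \<and> continuous_on I \<gamma> \<and> S = \<gamma> ` I)"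

text \<open>
  The unit-speed condition makes \<open>\<gamma>\<close> an arclength parametrization and \<open>T\<close> its unit tangent
  vector; at an endpoint belonging to \<open>I\<close> the derivative is one-sided.  The interval may be
  open, closed or half-open, so that curves can be cut into pairwise disjoint pieces.
\<close>
definition C1_bilipschitz_tangent_arc :: "(real \<times> real) set \<Rightarrow> bool" where
  "C1_bilipschitz_tangent_arc S \<longleftrightarrow>
    (\<exists>I \<gamma> T. nondegenerate_interval I \<and> S = \<gamma> ` I \<and>
      (\<forall>s\<in>I. (\<gamma> has_vector_derivative T s) (at s within I)) \<and> continuous_on I T \<and>
      (\<forall>s\<in>I. norm (T s) = 1) \<and>
      (\<exists>L\<ge>1. \<forall>s\<in>I. \<forall>t\<in>I.
         inverse L * \<bar>s - t\<bar> \<le> norm (T s - T t) \<and> norm (T s - T t) \<le> L * \<bar>s - t\<bar>))"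

definition piecewise_C1_bilipschitz_tangent :: "(real \<times> real) set \<Rightarrow> bool" where
  "piecewise_C1_bilipschitz_tangent S \<longleftrightarrow>
    (\<exists>F. finite F \<and> partition_on S F \<and> (\<forall>A\<in>F. C1_bilipschitz_tangent_arc A))"

text \<open>
  The value is an extended nonnegative real, so that no finiteness of the measure is presupposed.
\<close>
definition favard_curve_length :: "(real \<times> real) set \<Rightarrow> (real \<times> real) set \<Rightarrow> ennreal" where
  "favard_curve_length S E =
    emeasure lebesgue {(\<alpha>, \<beta>). (\<lambda>z. (\<alpha>, \<beta>) + z) ` S \<inter> E \<noteq> {}}"

lemma favard_curve_length_eq_difference:
  "favard_curve_length S E = emeasure lebesgue {p - z | p z. p \<in> E \<and> z \<in> S}"
proof -
  have "{(\<alpha>, \<beta>). (\<lambda>z. (\<alpha>, \<beta>) + z) ` S \<inter> E \<noteq> {}} = {p - z | p z. p \<in> E \<and> z \<in> S}"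
  proof (intro set_eqI iffI)
    fix w assume "w \<in> {(\<alpha>, \<beta>). (\<lambda>z. (\<alpha>, \<beta>) + z) ` S \<inter> E \<noteq> {}}"
    then obtain z where z: "z \<in> S" "w + z \<in> E"
      by (cases w) auto
    have "w = (w + z) - z"
      by simp
    then show "w \<in> {p - z | p z. p \<in> E \<and> z \<in> S}"
      using z by blast
  next
    fix w assume "w \<in> {p - z | p z. p \<in> E \<and> z \<in> S}"
    then obtain p z where pz: "w = p - z" "p \<in> E" "z \<in> S"
      by blast
    then have "w + z \<in> (\<lambda>z. w + z) ` S \<inter> E"
      by auto
    then have "(\<lambda>z. w + z) ` S \<inter> E \<noteq> {}"
      by blast
    then show "w \<in> {(\<alpha>, \<beta>). (\<lambda>z. (\<alpha>, \<beta>) + z) ` S \<inter> E \<noteq> {}}"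
      by (cases w) simp
  qed
  then show ?thesis
    by (simp add: favard_curve_length_def)
qed

text \<open>For \<open>n = 0\<close> the sum is empty and the union is the unit interval.\<close>
definition cantor_generation :: "nat \<Rightarrow> real set" where
  "cantor_generation n =
    (\<Union>a \<in> {1..n} \<rightarrow>\<^sub>E {0, 3}. {(\<Sum>j=1..n. a j / 4 ^ j) .. (\<Sum>j=1..n. a j / 4 ^ j) + 1 / 4 ^ n})"

definition four_corner_cantor :: "nat \<Rightarrow> (real \<times> real) set" where
  "four_corner_cantor n = cantor_generation n \<times> cantor_generation n"

end

theory Submission
  imports Defs
begin

text \<open>
  The bound comes from the second moment method. Let \<open>\<delta> = 4\<^sup>-\<^sup>n\<close>. The set \<open>K\<^sub>n\<close> is a union of \<open>4\<^sup>n\<close> squares of side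
  \<open>\<delta>\<close>, and a curve carries about \<open>1 / \<delta>\<close> points that are \<open>\<delta>\<close>-separated. Translating each square by minus
  each of these points gives about \<open>16\<^sup>n\<close> squares of area \<open>\<delta>\<^sup>2 = 16\<^sup>-\<^sup>n\<close> inside \<open>K\<^sub>n - S\<close>, of total area about
  \<open>1\<close>. The Cauchy-Schwarz inequality (\<open>second_moment_lower_bound\<close>) bounds the area of their union from below,
  once at most \<open>C n 16\<^sup>n\<close> pairs of these translated squares are known to meet.

  Two translated squares, with corners \<open>g - z\<close> and \<open>g' - z'\<close>, meet only if the chord \<open>z' - z\<close> of the curve equals
  \<open>v = g' - g\<close> up to \<open>\<delta>\<close>. This is where curvature enters. The bi-Lipschitz tangent makes a piece of the curve the
  graph of a function \<open>h\<close> with \<open>\<bar>h' x - h' y\<bar> \<ge> c \<bar>x - y\<bar>\<close> (\<open>arc_contains_curved_graph\<close>). For a fixed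
  horizontal step \<open>p\<close> the function \<open>h (x + p) - h x\<close> then has a derivative of size at least \<open>c \<bar>p\<bar>\<close>, so a chord of
  length comparable to \<open>norm v\<close> that is known up to \<open>\<delta>\<close> determines its starting point up to a multiple of
  \<open>\<delta> / norm v\<close> (\<open>curved_graph_chord_determines_start\<close>). Hence at most \<open>C / norm v\<close> pairs of sample points realise \<open>v\<close>.

  It remains to bound the discrete energy, the sum of \<open>1 / norm (g - g')\<close> over pairs of distinct corners. In
  the critical dimension one each of the \<open>n\<close> scales contributes the same amount \<open>16\<^sup>n\<close>, so that the energy is at most
  \<open>2 n 16\<^sup>n\<close> (\<open>corners_energy\<close>). The number of scales is the source of the factor \<open>n\<^sup>-\<^sup>1\<close>.

  The translated squares bound the measure of \<open>K\<^sub>n - S\<close> from below only if that set is measurable, because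
  \<^const>\<open>emeasure\<close> vanishes on other sets. The parameter interval of the curve need not be closed, but it is a
  countable union of compact intervals, so the difference set is Borel (\<open>borel_compact_minus_curve\<close>).
\<close>

section \<open>Second moments and difference sets\<close>

text \<open>
  This is the Cauchy-Schwarz inequality for \<open>f = (\<Sum>i\<in>J. indicator (A i))\<close> and the indicator of the union that
  carries \<open>f\<close>. It is proved from the nonnegativity of the integral of the square of \<open>f - t * indicator U\<close>, a quadratic
  polynomial in \<open>t\<close>.
\<close>
lemma second_moment_lower_bound:
  fixes A :: "'i \<Rightarrow> 'a set"
  assumes fin: "finite J" and A: "\<And>i. i \<in> J \<Longrightarrow> A i \<in> fmeasurable M"
  shows "(\<Sum>i\<in>J. measure M (A i))\<^sup>2 \<le>
    measure M (\<Union>i\<in>J. A i) * (\<Sum>i\<in>J. \<Sum>j\<in>J. measure M (A i \<inter> A j))"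
proof -
  define U where "U = (\<Union>i\<in>J. A i)"
  define a b u where "a = (\<Sum>i\<in>J. measure M (A i))"
    and "b = (\<Sum>i\<in>J. \<Sum>j\<in>J. measure M (A i \<inter> A j))" and "u = measure M U"
  have U: "U \<in> fmeasurable M"
    unfolding U_def using fin A by (intro fmeasurable.finite_UN) auto
  have AA: "A i \<inter> A j \<in> fmeasurable M" if "i \<in> J" "j \<in> J" for i j
    using A that by (intro fmeasurable.Int) auto
  have int: "has_bochner_integral M (\<lambda>x. indicator B x :: real) (measure M B)"
    if "B \<in> fmeasurable M" for B
    using that by (intro has_bochner_integral_real_indicator) (auto simp: fmeasurable_def)
  have quadratic: "0 \<le> b - 2 * t * a + t\<^sup>2 * u" for t :: real
  proof -
    let ?f = "\<lambda>x. (\<Sum>i\<in>J. indicator (A i) x :: real)"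
    let ?g = "\<lambda>x. (\<Sum>i\<in>J. \<Sum>j\<in>J. indicator (A i \<inter> A j) x :: real)
                   - 2 * t * ?f x + t\<^sup>2 * indicator U x"
    have "has_bochner_integral M ?g (b - 2 * t * a + t\<^sup>2 * u)"
      unfolding a_def b_def u_def
      by (intro has_bochner_integral_add has_bochner_integral_diff has_bochner_integral_sum
          has_bochner_integral_mult_right int A AA U) auto
    then have "integral\<^sup>L M ?g = b - 2 * t * a + t\<^sup>2 * u"
      by (rule has_bochner_integral_integral_eq)
    moreover have "0 \<le> ?g x" for x
    proof -
      have "?f x * indicator U x = ?f x"
        unfolding sum_distrib_right by (intro sum.cong) (auto simp: U_def indicator_def)
      then have "?g x = (?f x - t * indicator U x)\<^sup>2"
        by (simp add: power2_eq_square algebra_simps sum_product indicator_inter_arith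
            flip: sum_distrib_left)
           (auto simp: indicator_def)
      then show ?thesis
        by simp
    qed
    then have "0 \<le> integral\<^sup>L M ?g"
      by (intro integral_nonneg_AE AE_I2)
    ultimately show ?thesis
      by simp
  qed
  have "a\<^sup>2 \<le> u * b"
  proof (cases "u = 0")
    case True
    \<comment> \<open>If the union is null, then so is every member of the family, and both sides vanish.\<close>
    have "measure M (A i) \<le> u" if "i \<in> J" for i
      unfolding u_def using that U A by (intro measure_mono_fmeasurable) (auto simp: U_def)
    then have "a \<le> 0"
      unfolding a_def using True by (intro sum_nonpos) auto
    moreover have "a \<ge> 0"
      by (simp add: a_def sum_nonneg)
    ultimately show ?thesis
      using True by simp
  next
    case False
    then have "u > 0"
      by (simp add: u_def less_le)
    \<comment> \<open>The quadratic is minimal at \<open>t = a / u\<close>.\<close>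
    then show ?thesis
      using quadratic[of "a / u"] by (simp add: field_simps power2_eq_square)
  qed
  then show ?thesis
    by (simp add: a_def b_def u_def U_def)
qed

text \<open>
  Rational endpoints exhaust an interval except for the endpoints that belong to it, so those are added to the
  admissible endpoints.
\<close>
lemma is_interval_countable_Union_Icc:
  fixes I :: "real set"
  assumes I: "is_interval I"
  shows "\<exists>P. countable P \<and> I = (\<Union>(p, q)\<in>P. {p..q})"
proof -
  note between = mem_is_interval_1_I[OF I]
  define R where "R = (\<rat> \<union> {x \<in> I. \<forall>y\<in>I. x \<le> y} \<union> {x \<in> I. \<forall>y\<in>I. y \<le> x}) \<inter> I"
  have singleton: "finite X" if "\<And>x y. x \<in> X \<Longrightarrow> y \<in> X \<Longrightarrow> x = y" for X :: "real set"
  proof (cases "X = {}")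
    case False
    then obtain a where "a \<in> X"
      by blast
    then have "X \<subseteq> {a}"
      using that by blast
    then show ?thesis
      by (rule finite_subset) simp
  qed simp
  have "finite {x \<in> I. \<forall>y\<in>I. x \<le> y}" "finite {x \<in> I. \<forall>y\<in>I. y \<le> x}"
    by (intro singleton; force intro: antisym)+
  then have "countable (R \<times> R)"
    unfolding R_def by (intro countable_SIGMA countable_Int1 countable_Un countable_rat countable_finite)
  moreover have "I = (\<Union>(p, q)\<in>R \<times> R. {p..q})"
  proof (intro subset_antisym subsetI)
    fix x assume x: "x \<in> I"
    have "\<exists>p\<in>R. p \<le> x"
    proof (cases "\<exists>y\<in>I. y < x")
      case True
      then obtain y r where "y \<in> I" "r \<in> \<rat>" "y < r" "r < x"
        using Rats_dense_in_real by blast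
      then have "r \<in> R"
        using between[of y x r] x by (simp add: R_def)
      then show ?thesis
        using \<open>r < x\<close> by (intro bexI[of _ r]) auto
    qed (use x in \<open>auto simp: R_def not_less\<close>)
    moreover have "\<exists>q\<in>R. x \<le> q"
    proof (cases "\<exists>y\<in>I. x < y")
      case True
      then obtain y r where "y \<in> I" "r \<in> \<rat>" "x < r" "r < y"
        using Rats_dense_in_real by blast
      then have "r \<in> R"
        using between[of x y r] x by (simp add: R_def)
      then show ?thesis
        using \<open>x < r\<close> by (intro bexI[of _ r]) auto
    qed (use x in \<open>auto simp: R_def not_less\<close>)
    ultimately show "x \<in> (\<Union>(p, q)\<in>R \<times> R. {p..q})"
      by auto
  qed (use between in \<open>auto simp: R_def\<close>)
  ultimately show ?thesis
    by blast
qed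

text \<open>
  A continuous image of an interval is a countable union of compact sets, and the difference set of two compact
  sets is compact.
\<close>
lemma borel_compact_minus_curve:
  fixes K S :: "'a :: euclidean_space set"
  assumes K: "compact K" and I: "is_interval (I :: real set)" and \<gamma>: "continuous_on I \<gamma>" "S = \<gamma> ` I"
  shows "{p - z | p z. p \<in> K \<and> z \<in> S} \<in> sets borel"
proof -
  obtain P where P: "countable P" "I = (\<Union>(p, q)\<in>P. {p..q})"
    using is_interval_countable_Union_Icc[OF I] by blast
  have "{p - z | p z. p \<in> K \<and> z \<in> S} =
      (\<Union>r\<in>P. {p - z | p z. p \<in> K \<and> z \<in> \<gamma> ` {fst r..snd r}})"
    unfolding \<gamma>(2) P(2) by (auto simp: case_prod_beta)
  also have "\<dots> \<in> sets borel"
  proof (rule sets.countable_UN''[OF P(1)])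
    fix r assume "r \<in> P"
    then have "continuous_on {fst r..snd r} \<gamma>"
      by (intro continuous_on_subset[OF \<gamma>(1)]) (auto simp: P(2) case_prod_beta)
    then show "{p - z | p z. p \<in> K \<and> z \<in> \<gamma> ` {fst r..snd r}} \<in> sets borel"
      by (intro borel_compact compact_differences K compact_continuous_image) auto
  qed
  finally show ?thesis .
qed

section \<open>Corners of the four-corner Cantor set and their energy\<close>

definition offsets :: "(real \<times> real) set" where
  "offsets = {0, 3/4} \<times> {0, 3/4}"

lemma offsetsE:
  assumes "e \<in> offsets"
  obtains "e = (0, 0)" | "e = (0, 3/4)" | "e = (3/4, 0)" | "e = (3/4, 3/4)"
  using assms by (auto simp: offsets_def)

lemma finite_card_offsets: "finite offsets" "card offsets = 4"
  by (auto simp: offsets_def card_cartesian_product simp del: insert_Times_insert)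

text \<open>
  The lower left corners of the squares of \<open>K\<^sub>n\<close>. The recursion prepends the most significant digit: it places four
  copies of generation \<open>n\<close>, scaled by \<open>1/4\<close>. This order of digits makes the energy below self-similar.
\<close>
primrec corners :: "nat \<Rightarrow> (real \<times> real) set" where
  "corners 0 = {0}"
| "corners (Suc n) = (\<lambda>(e, g). e + (1/4) *\<^sub>R g) ` (offsets \<times> corners n)"

lemma corners_coordinates:
  "g \<in> corners n \<Longrightarrow> 0 \<le> fst g \<and> fst g \<le> 1 - 1 / 4 ^ n \<and> 0 \<le> snd g \<and> snd g \<le> 1 - 1 / 4 ^ n"
proof (induction n arbitrary: g)
  case (Suc n)
  then obtain e h where "e \<in> offsets" "h \<in> corners n" "g = e + (1/4) *\<^sub>R h"
    by auto
  then show ?case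
    using Suc.IH[of h] by (auto elim!: offsetsE)
qed simp

text \<open>
  The recursion prepends digits, whereas \<^const>\<open>cantor_generation\<close> sums over digit sequences; the new
  leading digit shifts the sequence by one place.
\<close>
lemma corners_digit_expansion:
  assumes "g \<in> corners n"
  shows "\<exists>a\<in>{1..n} \<rightarrow>\<^sub>E {0, 3}. \<exists>b\<in>{1..n} \<rightarrow>\<^sub>E {0, 3}.
    g = ((\<Sum>j=1..n. a j / 4 ^ j), (\<Sum>j=1..n. b j / 4 ^ j))"
  using assms
proof (induction n arbitrary: g)
  case (Suc n)
  then obtain e g' where e: "e \<in> offsets" and g': "g' \<in> corners n" and g: "g = e + (1/4) *\<^sub>R g'"
    by auto
  obtain a b where ab: "a \<in> {1..n} \<rightarrow>\<^sub>E {0, 3}" "b \<in> {1..n} \<rightarrow>\<^sub>E {0, 3}"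
    "g' = ((\<Sum>j=1..n. a j / 4 ^ j), (\<Sum>j=1..n. b j / 4 ^ j))"
    using Suc.IH[OF g'] by blast
  define shift :: "real \<Rightarrow> (nat \<Rightarrow> real) \<Rightarrow> nat \<Rightarrow> real" where
    "shift d a j = (if j \<in> {1..Suc n} then if j = 1 then 4 * d else a (j - 1) else undefined)" for d a j
  have sum: "(\<Sum>j=1..Suc n. shift d a j / 4 ^ j) = d + (\<Sum>j=1..n. a j / 4 ^ j) / 4" for d a
  proof -
    have "(\<Sum>j=1..Suc n. shift d a j / 4 ^ j) = d + (\<Sum>j=Suc 1..Suc n. shift d a j / 4 ^ j)"
      by (subst sum.atLeast_Suc_atMost) (auto simp: shift_def)
    also have "(\<Sum>j=Suc 1..Suc n. shift d a j / 4 ^ j) = (\<Sum>j=1..n. shift d a (Suc j) / 4 ^ Suc j)"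
      by (rule sum.shift_bounds_cl_Suc_ivl)
    also have "\<dots> = (\<Sum>j=1..n. a j / 4 ^ j) / 4"
      unfolding sum_divide_distrib by (intro sum.cong) (auto simp: shift_def)
    finally show ?thesis .
  qed
  have mem: "shift d a \<in> {1..Suc n} \<rightarrow>\<^sub>E {0, 3}" if "a \<in> {1..n} \<rightarrow>\<^sub>E {0, 3}" "d \<in> {0, 3/4}" for d a
  proof (rule PiE_I)
    fix j assume "j \<in> {1..Suc n}"
    then show "shift d a j \<in> {0, 3}"
      using that PiE_mem[OF that(1), of "j - 1"]
      by (cases "j = 1"; cases j) (auto simp: shift_def)
  qed (auto simp: shift_def)
  have "g = ((\<Sum>j=1..Suc n. shift (fst e) a j / 4 ^ j), (\<Sum>j=1..Suc n. shift (snd e) b j / 4 ^ j))"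
    unfolding sum g ab(3) by (simp add: prod_eq_iff field_simps)
  then show ?case
    using mem[OF ab(1), of "fst e"] mem[OF ab(2), of "snd e"] e by (auto simp: offsets_def)
qed (auto simp: zero_prod_def)

lemma corner_square_subset:
  assumes "g \<in> corners n"
  shows "cbox g (g + (1 / 4 ^ n, 1 / 4 ^ n)) \<subseteq> four_corner_cantor n"
proof -
  obtain a b where "a \<in> {1..n} \<rightarrow>\<^sub>E {0, 3}" "b \<in> {1..n} \<rightarrow>\<^sub>E {0, 3}"
    "g = ((\<Sum>j=1..n. a j / 4 ^ j), (\<Sum>j=1..n. b j / 4 ^ j))"
    using corners_digit_expansion[OF assms] by blast
  then show ?thesis
    unfolding four_corner_cantor_def cantor_generation_def
    by (auto simp: cbox_Pair_eq)
qed

lemma compact_four_corner_cantor: "compact (four_corner_cantor n)"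
  unfolding four_corner_cantor_def cantor_generation_def
  by (intro compact_Times compact_UN finite_PiE) auto

text \<open>
  Corners in different quarter-scale copies differ by at least \<open>3/4\<close> minus the width of a copy in one coordinate. The
  bound \<open>1/2\<close> serves the energy; the extra term is what makes the separation constant \<open>3\<close> of \<open>corners_separated\<close> come
  out at the first generation.
\<close>
lemma norm_difference_children:
  assumes e: "e \<in> offsets" "e' \<in> offsets" "e \<noteq> e'"
    and g: "g \<in> corners n" "g' \<in> corners n"
  shows "norm ((e + (1/4) *\<^sub>R g) - (e' + (1/4) *\<^sub>R g')) \<ge> 1 / 2 + 1 / 4 ^ Suc n"
proof -
  let ?v = "(e + (1/4) *\<^sub>R g) - (e' + (1/4) *\<^sub>R g')"
  have far: "1 / 2 + 1 / 4 ^ Suc n \<le> \<bar>(a + (1/4) * x) - (a' + (1/4) * x')\<bar>"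
    if "a \<in> {0, 3/4}" "a' \<in> {0, 3/4}" "a \<noteq> a'"
      "0 \<le> x" "x \<le> 1 - 1 / 4 ^ n" "0 \<le> x'" "x' \<le> 1 - 1 / 4 ^ n" for a a' x x' :: real
  proof -
    define q :: real where "q = 1 / 4 ^ n"
    have "1 / 4 ^ Suc n = q / 4"
      by (simp add: q_def)
    moreover have "1 / 2 + q / 4 \<le> \<bar>(a + (1/4) * x) - (a' + (1/4) * x')\<bar>"
      using that unfolding q_def[symmetric] by auto
    ultimately show ?thesis
      by simp
  qed
  have "fst e \<noteq> fst e' \<or> snd e \<noteq> snd e'"
    using e(3) by (simp add: prod_eq_iff)
  then have "1 / 2 + 1 / 4 ^ Suc n \<le> \<bar>fst ?v\<bar> \<or> 1 / 2 + 1 / 4 ^ Suc n \<le> \<bar>snd ?v\<bar>"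
    using far[of "fst e" "fst e'" "fst g" "fst g'"] far[of "snd e" "snd e'" "snd g" "snd g'"] e(1,2)
      corners_coordinates[OF g(1)] corners_coordinates[OF g(2)]
    by (auto simp: offsets_def)
  moreover have "\<bar>fst ?v\<bar> \<le> norm ?v" "\<bar>snd ?v\<bar> \<le> norm ?v"
    by (metis norm_fst_le norm_snd_le prod.collapse real_norm_def)+
  ultimately show ?thesis
    by linarith
qed

lemma inj_on_children:
  "inj_on (\<lambda>(e, g). e + (1/4) *\<^sub>R g) (offsets \<times> corners n)"
proof (rule inj_onI, clarify)
  fix e g e' g'
  assume *: "e + (1/4) *\<^sub>R g = e' + (1/4) *\<^sub>R g'"
    and g: "g \<in> corners n" "g' \<in> corners n" and e: "e \<in> offsets" "e' \<in> offsets"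
  have "e = e'"
  proof (rule ccontr)
    assume "e \<noteq> e'"
    then have "1 / 2 + 1 / 4 ^ Suc n \<le> (0 :: real)"
      using norm_difference_children[OF e _ g] * by simp
    moreover have "0 \<le> (1 :: real) / 4 ^ Suc n"
      by simp
    ultimately show False
      by linarith
  qed
  then show "e = e' \<and> g = g'"
    using * by simp
qed

lemma finite_corners: "finite (corners n)"
  by (induction n) (auto simp: finite_card_offsets)

lemma card_corners: "card (corners n) = 4 ^ n"
proof (induction n)
  case (Suc n)
  then show ?case
    by (simp add: card_image[OF inj_on_children] card_cartesian_product finite_card_offsets)
qed simp

text \<open>
  Corners are \<open>3 \<delta>\<close> apart, which exceeds the error \<open>2 \<delta>\<close> that the meeting of two squares of side \<open>\<delta>\<close> leaves in their
  offset. So two squares at different corners can meet only along a chord of length comparable to the distance of the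
  corners.
\<close>
lemma corners_separated:
  assumes "g \<in> corners n" "g' \<in> corners n" "g \<noteq> g'"
  shows "norm (g - g') \<ge> 3 / 4 ^ n"
  using assms
proof (induction n arbitrary: g g')
  case (Suc n)
  then obtain e h e' h' where *: "e \<in> offsets" "e' \<in> offsets"
    "h \<in> corners n" "h' \<in> corners n" "g = e + (1/4) *\<^sub>R h" "g' = e' + (1/4) *\<^sub>R h'"
    by auto
  show ?case
  proof (cases "e = e'")
    case True
    then have "g - g' = (1/4) *\<^sub>R (h - h')" and "h \<noteq> h'"
      using * Suc.prems by (auto simp: scaleR_diff_right)
    then show ?thesis
      using Suc.IH[OF *(3,4)] by simp
  next
    case False
    have "3 / 4 ^ Suc n \<le> 1 / 2 + 1 / (4 ^ Suc n :: real)"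
      using one_le_power[of "4 :: real" n] by (simp add: field_simps)
    also have "\<dots> \<le> norm (g - g')"
      unfolding *(5,6) by (rule norm_difference_children[OF *(1,2) False *(3,4)])
    finally show ?thesis .
  qed
qed simp

text \<open>
  The diagonal terms are \<open>0\<close>, by the convention \<open>inverse 0 = 0\<close>. Write \<open>E n\<close> for the left-hand side. A pair in the same
  quarter-scale copy contributes four times what the unscaled pair does, which yields \<open>4 * 4 * E n\<close>; a pair in different copies
  contributes at most \<open>2\<close>. Hence \<open>E (Suc n) \<le> 16 * E n + 32 * 16 ^ n\<close>, and the last term is added once per generation.
\<close>
lemma corners_energy:
  "(\<Sum>g\<in>corners n. \<Sum>g'\<in>corners n. inverse (norm (g - g'))) \<le> 2 * real n * 16 ^ n"
proof (induction n)
  case (Suc n)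
  let ?D = "offsets"
  let ?k = "\<lambda>e e'. \<Sum>g\<in>corners n. \<Sum>g'\<in>corners n.
     inverse (norm ((e + (1/4) *\<^sub>R g) - (e' + (1/4) *\<^sub>R g')))"
  have "?k e e' \<le> (if e = e' then 4 * (2 * real n * 16 ^ n) else 2 * 16 ^ n)"
    if e: "e \<in> ?D" "e' \<in> ?D" for e e'
  proof (cases "e = e'")
    case True
    have "inverse (norm ((e + (1/4) *\<^sub>R g) - (e + (1/4) *\<^sub>R g'))) = 4 * inverse (norm (g - g'))" for g g'
    proof -
      have "(e + (1/4) *\<^sub>R g) - (e + (1/4) *\<^sub>R g') = (1/4) *\<^sub>R (g - g')"
        by (simp add: scaleR_diff_right)
      then have norm: "norm ((e + (1/4) *\<^sub>R g) - (e + (1/4) *\<^sub>R g')) = norm (g - g') / 4"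
        by (simp only: norm_scaleR)
      show ?thesis
        unfolding norm inverse_divide unfolding divide_inverse ..
    qed
    then show ?thesis
      using Suc.IH True by (simp add: sum_distrib_left[symmetric])
  next
    case False
    have "?k e e' \<le> (\<Sum>g\<in>corners n. \<Sum>g'\<in>corners n. 2)"
    proof (intro sum_mono)
      fix g g' assume "g \<in> corners n" "g' \<in> corners n"
      then have "1 / 2 + 1 / 4 ^ Suc n \<le> norm ((e + (1/4) *\<^sub>R g) - (e' + (1/4) *\<^sub>R g'))"
        by (rule norm_difference_children[OF e False])
      moreover have "0 \<le> (1 :: real) / 4 ^ Suc n"
        by simp
      ultimately have "1 / 2 \<le> norm ((e + (1/4) *\<^sub>R g) - (e' + (1/4) *\<^sub>R g'))"
        by linarith
      then have "inverse (norm ((e + (1/4) *\<^sub>R g) - (e' + (1/4) *\<^sub>R g'))) \<le> inverse (1 / 2)"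
        by (rule le_imp_inverse_le) simp
      then show "inverse (norm ((e + (1/4) *\<^sub>R g) - (e' + (1/4) *\<^sub>R g'))) \<le> 2"
        by simp
    qed
    also have "\<dots> = 2 * 16 ^ n"
      by (simp add: card_corners flip: power_mult_distrib)
    finally show ?thesis
      using False by simp
  qed
  then have "(\<Sum>e\<in>?D. \<Sum>e'\<in>?D. ?k e e') \<le>
      (\<Sum>e\<in>?D. \<Sum>e'\<in>?D. if e = e' then 4 * (2 * real n * 16 ^ n) else 2 * 16 ^ n)"
    by (intro sum_mono)
  also have "\<dots> \<le> (\<Sum>e\<in>?D. \<Sum>e'\<in>?D. (if e = e' then 4 * (2 * real n * 16 ^ n) else 0) + 2 * 16 ^ n)"
    by (intro sum_mono) auto
  also have "\<dots> = 2 * real (Suc n) * 16 ^ Suc n"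
    by (simp add: sum.distrib finite_card_offsets algebra_simps)
  also have "(\<Sum>e\<in>?D. \<Sum>e'\<in>?D. ?k e e') =
      (\<Sum>g\<in>corners (Suc n). \<Sum>g'\<in>corners (Suc n). inverse (norm (g - g')))"
  proof -
    have reindex: "(\<Sum>g\<in>corners (Suc n). F g) = (\<Sum>e\<in>?D. \<Sum>g\<in>corners n. F (e + (1/4) *\<^sub>R g))"
      for F :: "real \<times> real \<Rightarrow> real"
      by (simp only: corners.simps sum.reindex[OF inj_on_children] sum.cartesian_product)
         (simp only: o_def case_prod_beta')
    have "(\<Sum>g\<in>corners (Suc n). \<Sum>g'\<in>corners (Suc n). inverse (norm (g - g'))) =
      (\<Sum>e\<in>?D. \<Sum>g\<in>corners n. \<Sum>e'\<in>?D. \<Sum>g'\<in>corners n.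
         inverse (norm ((e + (1/4) *\<^sub>R g) - (e' + (1/4) *\<^sub>R g'))))"
      by (simp only: reindex)
    also have "\<dots> = (\<Sum>e\<in>?D. \<Sum>e'\<in>?D. ?k e e')"
      by (intro sum.cong refl sum.swap)
    finally show ?thesis ..
  qed
  finally show ?case .
qed simp

section \<open>Graphs inside curved arcs\<close>

text \<open>
  The last condition is a sign-free form of strict convexity or concavity. Since only absolute values of
  differences of slopes are needed, the direction in which the curve bends never has to be determined.
\<close>
definition curved_graph :: "(real \<Rightarrow> real) \<Rightarrow> (real \<Rightarrow> real) \<Rightarrow> real \<Rightarrow> real \<Rightarrow> real \<Rightarrow> real \<Rightarrow> bool" where
  "curved_graph h h' A B M c \<longleftrightarrow> A < B \<and> 1 \<le> M \<and> 0 < c \<and>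
     (\<forall>x\<in>{A..B}. (h has_real_derivative h' x) (at x) \<and> \<bar>h' x\<bar> \<le> M) \<and>
     (\<forall>x\<in>{A..B}. \<forall>y\<in>{A..B}. c * \<bar>x - y\<bar> \<le> \<bar>h' x - h' y\<bar>)"

text \<open>
  Passing from a slope to the unit vector on the same side of the vertical axis is a contraction, so slopes inherit lower bounds
  for distances of unit tangents. With \<open>D\<close> the inner and \<open>k\<close> the cross product of the two vectors,
  \<open>D\<^sup>2 + k\<^sup>2 = 1\<close>, the squared distance is \<open>2 (1 - D)\<close>, and the slopes differ by \<open>k / (p r)\<close>.
\<close>
lemma unit_vector_dist_le_slope_dist:
  fixes v w :: "real \<times> real"
  assumes unit: "norm v = 1" "norm w = 1" and pos: "0 < fst v * fst w"
  shows "norm (v - w) \<le> \<bar>snd v / fst v - snd w / fst w\<bar>"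
proof -
  obtain p q r s where v: "v = (p, q)" and w: "w = (r, s)"
    by (cases v, cases w)
  have 1: "p\<^sup>2 + q\<^sup>2 = 1" "r\<^sup>2 + s\<^sup>2 = 1"
    using unit by (simp_all add: v w norm_Pair real_sqrt_eq_1_iff)
  define D where "D = p * r + q * s"
  define k where "k = q * r - p * s"
  have pr: "0 < p * r"
    using pos by (simp add: v w)
  have "D\<^sup>2 + k\<^sup>2 = (p\<^sup>2 + q\<^sup>2) * (r\<^sup>2 + s\<^sup>2)"
    unfolding D_def k_def by algebra
  then have "D\<^sup>2 + k\<^sup>2 = 1"
    by (simp add: 1)
  then have Dk: "k\<^sup>2 = (1 - D) * (1 + D)"
    by (simp add: algebra_simps power2_eq_square)
  \<comment> \<open>Comparing \<open>v\<close> with the reflection of \<open>w\<close> in the horizontal axis bounds \<open>p r\<close> by \<open>D\<close>.\<close>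
  have "0 \<le> (p - r)\<^sup>2 + (q + s)\<^sup>2"
    by simp
  also have "\<dots> = (p\<^sup>2 + q\<^sup>2) + (r\<^sup>2 + s\<^sup>2) + 2 * D - 4 * (p * r)"
    unfolding D_def by algebra
  finally have pr_le: "2 * (p * r) \<le> 1 + D"
    using 1 by simp
  have D1: "D \<le> 1"
  proof -
    have "0 \<le> (p - r)\<^sup>2 + (q - s)\<^sup>2"
      by simp
    also have "\<dots> = (p\<^sup>2 + q\<^sup>2) + (r\<^sup>2 + s\<^sup>2) - 2 * D"
      unfolding D_def by algebra
    finally show ?thesis
      using 1 by simp
  qed
  have "2 * (1 - D) * (p * r)\<^sup>2 \<le> k\<^sup>2"
  proof -
    have "2 * (p * r)\<^sup>2 \<le> 1 + D"
      using pr_le D1 pr mult_left_le[of "p * r" "p * r"] by (simp add: power2_eq_square)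
    then have "(1 - D) * (2 * (p * r)\<^sup>2) \<le> (1 - D) * (1 + D)"
      using D1 by (intro mult_left_mono) auto
    then show ?thesis
      by (simp add: Dk algebra_simps)
  qed
  then have le: "2 * (1 - D) \<le> (k / (p * r))\<^sup>2"
    using pr zero_less_power[OF pr, of 2] unfolding power_divide by (simp add: pos_le_divide_eq)
  have "(norm (v - w))\<^sup>2 = (p - r)\<^sup>2 + (q - s)\<^sup>2"
    by (simp add: v w norm_Pair)
  also have "\<dots> = (p\<^sup>2 + q\<^sup>2) + (r\<^sup>2 + s\<^sup>2) - 2 * D"
    unfolding D_def by algebra
  also have "\<dots> \<le> \<bar>k / (p * r)\<bar>\<^sup>2"
    using le 1 by (simp del: abs_divide)
  finally have "norm (v - w) \<le> \<bar>k / (p * r)\<bar>"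
    by (rule power2_le_imp_le) simp
  moreover have "p \<noteq> 0" "r \<noteq> 0"
    using pr by auto
  then have "q / p - s / r = k / (p * r)"
    by (simp add: k_def field_simps)
  ultimately show ?thesis
    by (simp add: v w)
qed

text \<open>
  Only two unit vectors are vertical, so an injective tangent is vertical at two parameters at most. This makes
  it unnecessary to treat graphs over the vertical axis.
\<close>
lemma exists_nonvertical_tangent:
  fixes T :: "real \<Rightarrow> real \<times> real"
  assumes "open U" "U \<noteq> {}" "inj_on T U" "\<And>s. s \<in> U \<Longrightarrow> norm (T s) = 1"
  shows "\<exists>s\<in>U. fst (T s) \<noteq> 0"
proof (rule ccontr)
  assume not: "\<not> ?thesis"
  have "T s \<in> {(0, 1), (0, -1)}" if s: "s \<in> U" for s
  proof -
    have "fst (T s) = 0" "(snd (T s))\<^sup>2 = 1"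
      using assms(4)[OF s] s not by (auto simp: norm_prod_def)
    then show ?thesis
      by (auto simp: prod_eq_iff power2_eq_1_iff)
  qed
  then have "T ` U \<subseteq> {(0, 1), (0, -1)}"
    by blast
  then have "finite (T ` U)"
    by (rule finite_subset) simp
  then have "finite U"
    using assms(3) by (simp add: finite_image_iff)
  then show False
    using assms(1,2) by (metis finite_imp_not_open)
qed

text \<open>
  Near a parameter with nonvertical tangent, the abscissa \<open>X\<close> is an invertible function of arclength, and
  \<open>h = Y \<circ> G\<close> with \<open>G\<close> the inverse of \<open>X\<close>. The slope of \<open>h\<close> separates points because the tangent does and because
  \<open>X\<close> does not increase distances.
\<close>
lemma arc_contains_curved_graph:
  assumes "C1_bilipschitz_tangent_arc S"
  shows "\<exists>h h' A B M c. curved_graph h h' A B M c \<and> (\<forall>x\<in>{A..B}. (x, h x) \<in> S)"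
proof -
  obtain I \<gamma> T L where I: "nondegenerate_interval I" and S: "S = \<gamma> ` I"
    and deriv: "\<And>s. s \<in> I \<Longrightarrow> (\<gamma> has_vector_derivative T s) (at s within I)"
    and contT: "continuous_on I T" and unit: "\<And>s. s \<in> I \<Longrightarrow> norm (T s) = 1" and L: "L \<ge> 1"
    and lip: "\<And>s t. s \<in> I \<Longrightarrow> t \<in> I \<Longrightarrow> inverse L * \<bar>s - t\<bar> \<le> norm (T s - T t)"
    using assms unfolding C1_bilipschitz_tangent_arc_def by blast
  have int: "interior I \<subseteq> I" "open (interior I)" "interior I \<noteq> {}"
    using I by (auto simp: nondegenerate_interval_def interior_subset)
  have injT: "inj_on T (interior I)"
  proof (rule inj_onI)
    fix s t assume "s \<in> interior I" "t \<in> interior I" "T s = T t"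
    then have "inverse L * \<bar>s - t\<bar> \<le> 0"
      using lip[of s t] int by auto
    then show "s = t"
      using L by (simp add: mult_le_0_iff)
  qed
  obtain s0 where s0: "s0 \<in> interior I" "fst (T s0) \<noteq> 0"
    using exists_nonvertical_tangent[OF int(2,3) injT] unit int(1) by blast
  define \<mu> where "\<mu> = \<bar>fst (T s0)\<bar> / 2"
  have \<mu>: "\<mu> > 0"
    using s0 by (simp add: \<mu>_def)
  have "isCont T s0"
    using contT s0(1) by (rule continuous_on_interior)
  then have "isCont (\<lambda>s. fst (T s)) s0"
    by (intro continuous_intros)
  then obtain r1 where r1: "r1 > 0" "\<And>s. dist s s0 < r1 \<Longrightarrow> \<bar>fst (T s) - fst (T s0)\<bar> < \<mu>"
    using \<mu> unfolding continuous_at_eps_delta dist_real_def by blast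
  obtain r2 where r2: "r2 > 0" "ball s0 r2 \<subseteq> interior I"
    using int(2) s0(1) open_contains_ball by blast
  define r where "r = min r1 r2 / 2"
  have r: "0 < r" "r < r1" "r < r2"
    using r1 r2 by (auto simp: r_def min_def)
  define a b where "a = s0 - r" and "b = s0 + r"
  have ab: "a < b"
    using r by (simp add: a_def b_def)
  have J: "s \<in> interior I" "s \<in> I" "\<bar>fst (T s) - fst (T s0)\<bar> < \<mu>" if "s \<in> {a..b}" for s
  proof -
    have "dist s s0 < r1" "s \<in> ball s0 r2"
      using that r by (auto simp: a_def b_def dist_real_def abs_if)
    then show "s \<in> interior I" "s \<in> I" "\<bar>fst (T s) - fst (T s0)\<bar> < \<mu>"
      using r1 r2 int by blast+
  qed
  have T_fst: "\<mu> \<le> \<bar>fst (T s)\<bar>" if "s \<in> {a..b}" for s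
    using J(3)[OF that] unfolding \<mu>_def by linarith
  have T_same_sign: "0 < fst (T s) * fst (T t)" if "s \<in> {a..b}" "t \<in> {a..b}" for s t
  proof (cases "fst (T s0) > 0")
    case True
    then have "0 < fst (T s)" "0 < fst (T t)"
      using J(3)[OF that(1)] J(3)[OF that(2)] unfolding \<mu>_def by linarith+
    then show ?thesis
      by simp
  next
    case False
    then have "fst (T s) < 0" "fst (T t) < 0"
      using J(3)[OF that(1)] J(3)[OF that(2)] s0(2) unfolding \<mu>_def by linarith+
    then show ?thesis
      by (simp add: mult_neg_neg)
  qed
  define X Y where "X = (\<lambda>s. fst (\<gamma> s))" and "Y = (\<lambda>s. snd (\<gamma> s))"
  have d: "(\<gamma> has_vector_derivative T s) (at s)" if "s \<in> {a..b}" for s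
    using deriv[OF J(2)[OF that]] at_within_interior[OF J(1)[OF that]] by simp
  have dX: "(X has_real_derivative fst (T s)) (at s)"
    and dY: "(Y has_real_derivative snd (T s)) (at s)" if "s \<in> {a..b}" for s
    unfolding X_def Y_def has_real_derivative_iff_has_vector_derivative
    using bounded_linear.has_vector_derivative[OF bounded_linear_fst d[OF that]]
      bounded_linear.has_vector_derivative[OF bounded_linear_snd d[OF that]] by auto
  have contX: "continuous_on {a..b} X"
    by (intro continuous_at_imp_continuous_on ballI DERIV_isCont[OF dX])
  have X_mvt: "\<exists>\<xi>\<in>{a..b}. X t - X s = fst (T \<xi>) * (t - s)" if "s \<in> {a..b}" "t \<in> {a..b}" "s < t" for s t
    using MVT2[OF that(3), of X "\<lambda>s. fst (T s)"] dX that by force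
  have injX: "inj_on X {a..b}"
  proof (rule linorder_inj_onI)
    fix s t assume st: "s < t" "s \<in> {a..b}" "t \<in> {a..b}"
    then obtain \<xi> where "\<xi> \<in> {a..b}" "X t - X s = fst (T \<xi>) * (t - s)"
      using X_mvt by blast
    then show "X s \<noteq> X t"
      using T_fst[of \<xi>] \<mu> st by auto
  qed auto
  have X_lip: "\<bar>X s - X t\<bar> \<le> \<bar>s - t\<bar>" if "s \<in> {a..b}" "t \<in> {a..b}" for s t
    using that
  proof (induction s t rule: linorder_wlog)
    case (le s t)
    show ?case
    proof (cases "s = t")
      case False
      then obtain \<xi> where \<xi>: "\<xi> \<in> {a..b}" "X t - X s = fst (T \<xi>) * (t - s)"
        using X_mvt le by force
      have "\<bar>fst (T \<xi>)\<bar> \<le> 1"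
        using unit[OF J(2)[OF \<xi>(1)]] by (metis norm_fst_le prod.collapse real_norm_def)
      then have "\<bar>fst (T \<xi>)\<bar> * \<bar>t - s\<bar> \<le> 1 * \<bar>t - s\<bar>"
        by (intro mult_right_mono) auto
      then have "\<bar>X t - X s\<bar> \<le> \<bar>t - s\<bar>"
        unfolding \<xi>(2) by (simp add: abs_mult)
      then show ?thesis
        by (simp add: abs_minus_commute)
    qed auto
  qed (simp add: abs_minus_commute)
  define G where "G = the_inv_into {a..b} X"
  have GX: "G (X s) = s" if "s \<in> {a..b}" for s
    using the_inv_into_f_f[OF injX that] by (simp add: G_def)
  have "compact (X ` {a..b})" "connected (X ` {a..b})"
    using contX by (auto intro: compact_continuous_image connected_continuous_image)
  then obtain A B where AB: "X ` {a..b} = {A..B}"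
    by (metis connected_compact_interval_1)
  have "X a \<in> {A..B}" "X b \<in> {A..B}" "X a \<noteq> X b"
    using AB ab inj_onD[OF injX, of a b] by auto
  then have "A < B"
    by auto
  have G_mem: "G x \<in> {a..b}" and XG: "X (G x) = x" if x: "x \<in> {A..B}" for x
    using x the_inv_into_into[OF injX, of x "{a..b}"] f_the_inv_into_f[OF injX, of x]
    unfolding G_def AB[symmetric] by auto
  have contG: "continuous_on {A..B} G"
    using continuous_on_inv[OF contX compact_Icc] GX AB by auto
  \<comment> \<open>The inverse function is differentiable in the interior only, hence the middle third.\<close>
  define A' B' where "A' = A + (B - A) / 3" and "B' = A + 2 * (B - A) / 3"
  have A'B': "A < A'" "A' < B'" "B' < B"
    using \<open>A < B\<close> by (auto simp: A'_def B'_def field_simps)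
  define h h' where "h = (\<lambda>x. Y (G x))" and "h' = (\<lambda>x. snd (T (G x)) / fst (T (G x)))"
  have deriv_h: "(h has_real_derivative h' x) (at x)" if "x \<in> {A'..B'}" for x
  proof -
    have x: "A < x" "x < B"
      using that A'B' by auto
    have "isCont G x"
      using contG x by (simp add: continuous_on_interior)
    then have "(G has_real_derivative inverse (fst (T (G x)))) (at x)"
      using x XG G_mem dX T_fst[of "G x"] \<mu>
      by (intro DERIV_inverse_function[where f = X and a = A and b = B]) auto
    then have "((\<lambda>x. Y (G x)) has_real_derivative snd (T (G x)) * inverse (fst (T (G x)))) (at x)"
      using x G_mem by (intro DERIV_chain2[OF dY]) auto
    then show ?thesis
      by (simp add: h_def h'_def field_simps)
  qed
  have in_AB: "x \<in> {A..B}" if "x \<in> {A'..B'}" for x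
    using that A'B' by auto
  have bound_h': "\<bar>h' x\<bar> \<le> max 1 (1 / \<mu>)" if "x \<in> {A'..B'}" for x
  proof -
    have G: "G x \<in> {a..b}"
      using that in_AB G_mem by blast
    have "\<bar>snd (T (G x))\<bar> \<le> 1"
      using unit[OF J(2)[OF G]] by (metis norm_snd_le prod.collapse real_norm_def)
    then have "\<bar>h' x\<bar> \<le> 1 / \<mu>"
      unfolding h'_def abs_divide using T_fst[OF G] \<mu> by (intro frac_le) auto
    then show ?thesis
      by simp
  qed
  have curved_h': "inverse L * \<bar>x - y\<bar> \<le> \<bar>h' x - h' y\<bar>" if xy: "x \<in> {A'..B'}" "y \<in> {A'..B'}" for x y
  proof -
    have G: "G x \<in> {a..b}" "G y \<in> {a..b}"
      using xy in_AB G_mem by blast+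
    have "\<bar>x - y\<bar> \<le> \<bar>G x - G y\<bar>"
      using X_lip[OF G] XG[OF in_AB] xy by simp
    then have "inverse L * \<bar>x - y\<bar> \<le> inverse L * \<bar>G x - G y\<bar>"
      using L by (intro mult_left_mono) auto
    also have "\<dots> \<le> norm (T (G x) - T (G y))"
      using lip G J by blast
    also have "\<dots> \<le> \<bar>h' x - h' y\<bar>"
      unfolding h'_def using G J unit T_same_sign by (intro unit_vector_dist_le_slope_dist) auto
    finally show ?thesis .
  qed
  have "curved_graph h h' A' B' (max 1 (1 / \<mu>)) (inverse L)"
    unfolding curved_graph_def using A'B' L deriv_h bound_h' curved_h' by auto
  moreover have "(x, h x) \<in> S" if "x \<in> {A'..B'}" for x
  proof -
    have "(x, h x) = \<gamma> (G x)"
      using XG[OF in_AB[OF that]] by (simp add: prod_eq_iff h_def Y_def X_def)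
    then show ?thesis
      unfolding S using that in_AB G_mem J by blast
  qed
  ultimately show ?thesis
    by blast
qed

section \<open>Chords of curved graphs\<close>

lemma curved_graph_lipschitz:
  assumes "curved_graph h h' A B M c" "x \<in> {A..B}" "y \<in> {A..B}"
  shows "\<bar>h x - h y\<bar> \<le> M * \<bar>x - y\<bar>"
proof -
  have "norm (h x - h y) \<le> M * norm (x - y)"
    using assms unfolding curved_graph_def
    by (intro field_differentiable_bound[of "{A..B}" h h'])
       (auto intro: has_field_derivative_at_within)
  then show ?thesis
    by simp
qed

text \<open>
  The height of the chord over \<open>{x..x + p}\<close> has derivative \<open>h' (x + p) - h' x\<close> in \<open>x\<close>, which is at least
  \<open>c * \<bar>p\<bar>\<close> in absolute value; the mean value theorem does the rest.
\<close>
lemma curved_graph_chord_expansion: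
  assumes h: "curved_graph h h' A B M c"
    and mem: "x \<in> {A..B}" "x + p \<in> {A..B}" "y \<in> {A..B}" "y + p \<in> {A..B}"
  shows "c * \<bar>p\<bar> * \<bar>x - y\<bar> \<le> \<bar>(h (x + p) - h x) - (h (y + p) - h y)\<bar>"
  using mem
proof (induction x y rule: linorder_wlog)
  case (le x y)
  show ?case
  proof (cases "x = y")
    case False
    have d: "(h has_real_derivative h' t) (at t)" if "t \<in> {A..B}" for t
      using h that by (auto simp: curved_graph_def)
    have "((\<lambda>t. h (t + p) - h t) has_real_derivative h' (t + p) - h' t) (at t)" if "x \<le> t" "t \<le> y" for t
      using le that d[of t] d[of "t + p"] by (intro DERIV_diff) (auto simp: DERIV_shift)
    then obtain \<xi> where \<xi>: "x < \<xi>" "\<xi> < y"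
      "(h (y + p) - h y) - (h (x + p) - h x) = (y - x) * (h' (\<xi> + p) - h' \<xi>)"
      using MVT2[of x y "\<lambda>t. h (t + p) - h t" "\<lambda>t. h' (t + p) - h' t"] le False by auto
    have "c * \<bar>(\<xi> + p) - \<xi>\<bar> \<le> \<bar>h' (\<xi> + p) - h' \<xi>\<bar>"
      using h \<xi> le unfolding curved_graph_def by (meson atLeastAtMost_iff add_le_cancel_right less_imp_le order_trans)
    then have "c * \<bar>p\<bar> * \<bar>x - y\<bar> \<le> \<bar>h' (\<xi> + p) - h' \<xi>\<bar> * \<bar>x - y\<bar>"
      by (intro mult_right_mono) auto
    also have "\<dots> = \<bar>(h (y + p) - h y) - (h (x + p) - h x)\<bar>"
      unfolding \<xi>(3) by (simp add: abs_mult abs_minus_commute)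
    finally show ?thesis
      by (simp add: abs_minus_commute)
  qed auto
qed (auto simp: abs_minus_commute)

text \<open>
  Two chords that agree with \<open>v\<close> up to \<open>\<delta>\<close> need not have the same horizontal step, so the longer one is cut
  to the step of the shorter one before \<open>curved_graph_chord_expansion\<close> is applied; the Lipschitz bound controls the
  error. If the two steps have opposite signs, one of them is at most \<open>\<delta>\<close>, and then the claimed bound is at least \<open>B - A\<close>.
\<close>
lemma curved_graph_chord_determines_start:
  assumes h: "curved_graph h h' A B M c"
    and mem: "x \<in> {A..B}" "y \<in> {A..B}" "x' \<in> {A..B}" "y' \<in> {A..B}"
    and \<delta>: "0 < \<delta>" "3 * \<delta> \<le> norm v"
    and xy: "\<bar>y - x - fst v\<bar> \<le> \<delta>" "\<bar>h y - h x - snd v\<bar> \<le> \<delta>"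
    and xy': "\<bar>y' - x' - fst v\<bar> \<le> \<delta>" "\<bar>h y' - h x' - snd v\<bar> \<le> \<delta>"
  shows "\<bar>x - x'\<bar> \<le> (6 * (1 + M)\<^sup>2 / c + 3 * (1 + M) * (B - A)) * \<delta> / norm v"
proof -
  have M: "1 \<le> M" and c: "0 < c" and AB: "A < B"
    using h by (auto simp: curved_graph_def)
  have v: "0 < norm v"
    using \<delta> by linarith
  \<comment> \<open>Of the length of \<open>v\<close>, at most two thirds is lost to the error \<open>2 * \<delta>\<close>.\<close>
  have long: "norm v \<le> 3 * (1 + M) * \<bar>y - x\<bar>"
    if "x \<in> {A..B}" "y \<in> {A..B}" "\<bar>y - x - fst v\<bar> \<le> \<delta>" "\<bar>h y - h x - snd v\<bar> \<le> \<delta>" for x y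
  proof -
    have "norm v \<le> \<bar>fst v\<bar> + \<bar>snd v\<bar>"
      using norm_Pair_le[of "fst v" "snd v"] by simp
    also have "\<dots> \<le> \<bar>y - x\<bar> + \<bar>h y - h x\<bar> + 2 * \<delta>"
      using that(3,4) by linarith
    also have "\<bar>h y - h x\<bar> \<le> M * \<bar>y - x\<bar>"
      using curved_graph_lipschitz[OF h that(2,1)] .
    finally show ?thesis
      using \<delta> by (simp add: algebra_simps)
  qed
  have key: "\<bar>x - x'\<bar> \<le> 6 * (1 + M)\<^sup>2 / c * \<delta> / norm v"
    if mem: "x \<in> {A..B}" "y \<in> {A..B}" "x' \<in> {A..B}" "y' \<in> {A..B}"
    and xy: "\<bar>y - x - fst v\<bar> \<le> \<delta>" "\<bar>h y - h x - snd v\<bar> \<le> \<delta>"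
    and xy': "\<bar>y' - x' - fst v\<bar> \<le> \<delta>" "\<bar>h y' - h x' - snd v\<bar> \<le> \<delta>"
    and le: "\<bar>y - x\<bar> \<le> \<bar>y' - x'\<bar>" and sign: "0 \<le> (y - x) * (y' - x')" for x y x' y'
  proof -
    define p where "p = y - x"
    have p: "norm v \<le> 3 * (1 + M) * \<bar>p\<bar>"
      using long[OF mem(1,2) xy] by (simp add: p_def)
    have in_AB: "x' + p \<in> {A..B}"
      using mem le sign by (auto simp: p_def zero_le_mult_iff)
    have "c * \<bar>p\<bar> * \<bar>x - x'\<bar> \<le> \<bar>(h y - h x) - (h (x' + p) - h x')\<bar>"
      using curved_graph_chord_expansion[OF h mem(1) _ mem(3) in_AB] mem(2) by (simp add: p_def)
    also have "\<dots> \<le> 2 * \<delta> + \<bar>h y' - h (x' + p)\<bar>"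
      using xy(2) xy'(2) by linarith
    also have "\<dots> \<le> 2 * \<delta> + M * \<bar>y' - (x' + p)\<bar>"
      using curved_graph_lipschitz[OF h mem(4) in_AB] by simp
    also have "\<dots> \<le> 2 * \<delta> + M * (2 * \<delta>)"
      using xy(1) xy'(1) M unfolding p_def by (intro add_left_mono mult_left_mono) linarith+
    finally have *: "c * \<bar>p\<bar> * \<bar>x - x'\<bar> \<le> 2 * (1 + M) * \<delta>"
      by (simp add: algebra_simps)
    have "c * norm v * \<bar>x - x'\<bar> \<le> c * (3 * (1 + M) * \<bar>p\<bar>) * \<bar>x - x'\<bar>"
      using c p by (intro mult_right_mono mult_left_mono) auto
    also have "\<dots> = 3 * (1 + M) * (c * \<bar>p\<bar> * \<bar>x - x'\<bar>)"
      by simp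
    also have "\<dots> \<le> 3 * (1 + M) * (2 * (1 + M) * \<delta>)"
      using * M by (intro mult_left_mono) auto
    finally show ?thesis
      using c v by (simp add: field_simps power2_eq_square)
  qed
  have nonneg: "0 \<le> 6 * (1 + M)\<^sup>2 / c * \<delta> / norm v" "0 \<le> 3 * (1 + M) * (B - A) * \<delta> / norm v"
    using c \<delta> M AB v by auto
  have "\<bar>x - x'\<bar> \<le> 6 * (1 + M)\<^sup>2 / c * \<delta> / norm v + 3 * (1 + M) * (B - A) * \<delta> / norm v"
  proof (cases "0 \<le> (y - x) * (y' - x')")
    case True
    show ?thesis
    proof (cases "\<bar>y - x\<bar> \<le> \<bar>y' - x'\<bar>")
      case le: True
      show ?thesis
        using key[OF mem xy xy' le True] nonneg by linarith
    next
      case False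
      have "\<bar>x' - x\<bar> \<le> 6 * (1 + M)\<^sup>2 / c * \<delta> / norm v"
        using key[OF mem(3,4,1,2) xy' xy] True False by (simp add: mult.commute)
      then show ?thesis
        using nonneg by linarith
    qed
  next
    case False
    then have "\<bar>y - x\<bar> + \<bar>y' - x'\<bar> = \<bar>(y - x) - (y' - x')\<bar>"
      by (auto simp: not_le mult_less_0_iff)
    also have "\<dots> \<le> 2 * \<delta>"
      using xy xy' by linarith
    finally have "\<bar>y - x\<bar> \<le> \<delta> \<or> \<bar>y' - x'\<bar> \<le> \<delta>"
      by linarith
    then have "3 * (1 + M) * \<bar>y - x\<bar> \<le> 3 * (1 + M) * \<delta> \<or> 3 * (1 + M) * \<bar>y' - x'\<bar> \<le> 3 * (1 + M) * \<delta>"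
      using M by auto
    then have "norm v \<le> 3 * (1 + M) * \<delta>"
      using long[OF mem(1,2) xy] long[OF mem(3,4) xy'] by linarith
    then have "(B - A) * norm v \<le> (B - A) * (3 * (1 + M) * \<delta>)"
      using AB by (intro mult_left_mono) auto
    then have "B - A \<le> 3 * (1 + M) * (B - A) * \<delta> / norm v"
      using v by (simp add: field_simps)
    moreover have "\<bar>x - x'\<bar> \<le> B - A"
      using mem by (auto simp: abs_if)
    ultimately show ?thesis
      using nonneg by linarith
  qed
  then show ?thesis
    by (simp add: add_divide_distrib distrib_right)
qed

lemma card_le_diameter:
  fixes X :: "nat set"
  assumes "finite X" "0 \<le> D" and diam: "\<And>i j. i \<in> X \<Longrightarrow> j \<in> X \<Longrightarrow> \<bar>real i - real j\<bar> \<le> D"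
  shows "real (card X) \<le> D + 1"
proof (cases "X = {}")
  case False
  have "X \<subseteq> {Min X..Min X + nat \<lfloor>D\<rfloor>}"
  proof
    fix i assume i: "i \<in> X"
    then have "Min X \<le> i" "real i - real (Min X) \<le> D"
      using diam[OF i Min_in[OF assms(1) False]] assms(1) by auto
    then have "i - Min X \<le> nat \<lfloor>D\<rfloor>"
      by (simp add: le_nat_floor of_nat_diff)
    then show "i \<in> {Min X..Min X + nat \<lfloor>D\<rfloor>}"
      using \<open>Min X \<le> i\<close> by auto
  qed
  then have "card X \<le> nat \<lfloor>D\<rfloor> + 1"
    using card_mono[of "{Min X..Min X + nat \<lfloor>D\<rfloor>}" X] by simp
  then have "real (card X) \<le> real (nat \<lfloor>D\<rfloor>) + 1"
    by linarith
  also have "real (nat \<lfloor>D\<rfloor>) \<le> D"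
    using assms(2) by simp
  finally show ?thesis
    by simp
qed (use assms in auto)

text \<open>
  The sample points have abscissas \<open>A + 3 \<delta> i\<close>. The spacing \<open>3 \<delta>\<close> exceeds the uncertainty \<open>2 \<delta>\<close> in the end point
  of a chord with given start, so that the end point is unique.
\<close>
definition grid_chords :: "(real \<Rightarrow> real) \<Rightarrow> real \<Rightarrow> real \<Rightarrow> nat \<Rightarrow> real \<times> real \<Rightarrow> (nat \<times> nat) set" where
  "grid_chords h A \<delta> N v = {(i, j). i < N \<and> j < N \<and>
     \<bar>(A + 3 * \<delta> * real j) - (A + 3 * \<delta> * real i) - fst v\<bar> \<le> \<delta> \<and>
     \<bar>h (A + 3 * \<delta> * real j) - h (A + 3 * \<delta> * real i) - snd v\<bar> \<le> \<delta>}"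

lemma grid_index_eq:
  assumes "0 < \<delta>" "\<bar>3 * \<delta> * real i - 3 * \<delta> * real j\<bar> \<le> 2 * \<delta>"
  shows "i = j"
proof -
  have "\<delta> * (3 * \<bar>real i - real j\<bar>) = \<bar>3 * \<delta> * (real i - real j)\<bar>"
    using assms(1) by (simp add: abs_mult)
  also have "\<dots> \<le> \<delta> * 2"
    using assms(2) by (simp add: right_diff_distrib)
  finally have "3 * \<bar>real i - real j\<bar> \<le> 2"
    using assms(1) by simp
  then have "real_of_int \<bar>int i - int j\<bar> < 1"
    by simp
  then have "\<bar>int i - int j\<bar> < 1"
    by (simp only: of_int_less_1_iff)
  then show ?thesis
    by linarith
qed

lemma finite_grid_chords: "finite (grid_chords h A \<delta> N v)"
  by (rule finite_subset[of _ "{..<N} \<times> {..<N}"]) (auto simp: grid_chords_def)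

lemma inj_on_fst_grid_chords:
  assumes "0 < \<delta>"
  shows "inj_on fst (grid_chords h A \<delta> N v)"
proof (rule inj_onI)
  fix a b assume *: "a \<in> grid_chords h A \<delta> N v" "b \<in> grid_chords h A \<delta> N v" "fst a = fst b"
  then have "\<bar>3 * \<delta> * real (snd a) - 3 * \<delta> * real (snd b)\<bar> \<le> 2 * \<delta>"
    by (auto simp: grid_chords_def)
  then show "a = b"
    using grid_index_eq[OF assms] *(3) by (simp add: prod_eq_iff)
qed

text \<open>
  The start of a chord determines its end, and all starts lie within a multiple of \<open>\<delta> / norm v\<close> of each other, which
  allows for at most a multiple of \<open>1 / norm v\<close> of them, plus one, since the spacing is \<open>3 \<delta>\<close>.
\<close>
lemma card_grid_chords_le:
  assumes h: "curved_graph h h' A B M c"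
    and \<delta>: "0 < \<delta>" "3 * \<delta> \<le> norm v" and grid: "\<And>i. i < N \<Longrightarrow> A + 3 * \<delta> * real i \<le> B"
  shows "real (card (grid_chords h A \<delta> N v)) \<le>
    (2 * (1 + M)\<^sup>2 / c + (1 + M) * (B - A)) / norm v + 1"
proof -
  let ?x = "\<lambda>i. A + 3 * \<delta> * real i"
  let ?C = "2 * (1 + M)\<^sup>2 / c + (1 + M) * (B - A)"
  have mem: "?x i \<in> {A..B}" if "i < N" for i
    using grid[OF that] \<delta> by simp
  have C: "0 \<le> ?C"
    using h by (auto simp: curved_graph_def)
  have "\<bar>real (fst a) - real (fst b)\<bar> \<le> ?C / norm v"
    if a: "a \<in> grid_chords h A \<delta> N v" and b: "b \<in> grid_chords h A \<delta> N v" for a b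
  proof -
    have "\<bar>?x (fst a) - ?x (fst b)\<bar> \<le> (6 * (1 + M)\<^sup>2 / c + 3 * (1 + M) * (B - A)) * \<delta> / norm v"
      using a b unfolding grid_chords_def case_prod_beta mem_Collect_eq
      by (intro curved_graph_chord_determines_start[OF h, where y = "?x (snd a)" and y' = "?x (snd b)"]
          mem \<delta>) blast+
    also have "\<dots> = 3 * \<delta> * (?C / norm v)"
      by (simp add: algebra_simps)
    also have "\<bar>?x (fst a) - ?x (fst b)\<bar> = 3 * \<delta> * \<bar>real (fst a) - real (fst b)\<bar>"
      using \<delta>(1) by (simp add: abs_mult flip: right_diff_distrib)
    finally show ?thesis
      by (rule mult_left_le_imp_le) (use \<delta>(1) in simp)
  qed
  then have "real (card (fst ` grid_chords h A \<delta> N v)) \<le> ?C / norm v + 1"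
    using C by (intro card_le_diameter) (auto simp: finite_grid_chords)
  then show ?thesis
    by (simp add: card_image[OF inj_on_fst_grid_chords[OF \<delta>(1)]])
qed

lemma card_grid_chords_0_le:
  assumes "0 < \<delta>"
  shows "card (grid_chords h A \<delta> N 0) \<le> N"
proof -
  have "fst ` grid_chords h A \<delta> N 0 \<subseteq> {..<N}"
    by (auto simp: grid_chords_def)
  then have "card (fst ` grid_chords h A \<delta> N 0) \<le> card {..<N}"
    by (intro card_mono) auto
  then show ?thesis
    by (simp add: card_image[OF inj_on_fst_grid_chords[OF assms]])
qed

text \<open>
  The additive \<open>1\<close> in \<open>card_grid_chords_le\<close> is absorbed into \<open>2 / norm v\<close>, because corners are at distance at most
  \<open>2\<close>. Pairs of equal corners are counted separately.
\<close>
lemma chord_energy_le: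
  assumes h: "curved_graph h h' A B M c"
    and grid: "\<And>i. i < N \<Longrightarrow> A + 3 * (1 / 4 ^ n) * real i \<le> B"
  shows "(\<Sum>g\<in>corners n. \<Sum>g'\<in>corners n. real (card (grid_chords h A (1 / 4 ^ n) N (g' - g)))) \<le>
    4 ^ n * real N + (2 * (1 + M)\<^sup>2 / c + (1 + M) * (B - A) + 2) * (2 * real n * 16 ^ n)"
proof -
  let ?C = "2 * (1 + M)\<^sup>2 / c + (1 + M) * (B - A) + 2"
  have C: "0 \<le> ?C"
    using h by (auto simp: curved_graph_def)
  have "real (card (grid_chords h A (1 / 4 ^ n) N (g' - g))) \<le>
      (if g = g' then real N else 0) + ?C * inverse (norm (g - g'))"
    if g: "g \<in> corners n" "g' \<in> corners n" for g g'
  proof (cases "g = g'")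
    case True
    then show ?thesis
      using card_grid_chords_0_le[of "1 / 4 ^ n" h A N] by simp
  next
    case False
    then have pos: "0 < norm (g - g')"
      by simp
    have "0 \<le> (1 :: real) / 4 ^ n"
      by simp
    then have "\<bar>fst (g - g')\<bar> \<le> 1" "\<bar>snd (g - g')\<bar> \<le> 1"
      using corners_coordinates[OF g(1)] corners_coordinates[OF g(2)] unfolding fst_diff snd_diff
      by linarith+
    moreover have "norm (g - g') \<le> \<bar>fst (g - g')\<bar> + \<bar>snd (g - g')\<bar>"
      by (metis norm_Pair_le prod.collapse real_norm_def)
    ultimately have "norm (g - g') \<le> 2"
      by linarith
    then have "1 \<le> 2 * inverse (norm (g - g'))"
      using pos by (simp add: field_simps)
    moreover have "real (card (grid_chords h A (1 / 4 ^ n) N (g' - g))) \<le>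
        (2 * (1 + M)\<^sup>2 / c + (1 + M) * (B - A)) / norm (g' - g) + 1"
      using corners_separated[OF g(2,1)] False grid by (intro card_grid_chords_le[OF h]) auto
    ultimately show ?thesis
      using False by (simp add: norm_minus_commute divide_inverse algebra_simps)
  qed
  then have "(\<Sum>g\<in>corners n. \<Sum>g'\<in>corners n. real (card (grid_chords h A (1 / 4 ^ n) N (g' - g)))) \<le>
      (\<Sum>g\<in>corners n. \<Sum>g'\<in>corners n. (if g = g' then real N else 0) + ?C * inverse (norm (g - g')))"
    by (intro sum_mono)
  also have "\<dots> = 4 ^ n * real N +
      ?C * (\<Sum>g\<in>corners n. \<Sum>g'\<in>corners n. inverse (norm (g - g')))"
    by (simp only: sum.distrib sum_distrib_left) (simp add: finite_corners card_corners)
  also have "\<dots> \<le> 4 ^ n * real N + ?C * (2 * real n * 16 ^ n)"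
    using C by (intro add_left_mono mult_left_mono corners_energy)
  finally show ?thesis .
qed

section \<open>The lower bound\<close>

definition square :: "real \<times> real \<Rightarrow> real \<Rightarrow> (real \<times> real) set" where
  "square w \<delta> = cbox w (w + (\<delta>, \<delta>))"

lemma square_fmeasurable [simp]: "square w \<delta> \<in> fmeasurable lborel"
  by (simp add: square_def)

lemma measure_square: "0 \<le> \<delta> \<Longrightarrow> measure lborel (square w \<delta>) = \<delta>\<^sup>2"
  by (cases w) (simp add: square_def content_Pair power2_eq_square)

lemma squares_intersect_imp_close:
  assumes "square w \<delta> \<inter> square w' \<delta> \<noteq> {}"
  shows "\<bar>fst w - fst w'\<bar> \<le> \<delta>" "\<bar>snd w - snd w'\<bar> \<le> \<delta>"
  using assms by (cases w; cases w'; auto simp: square_def cbox_Pair_eq)+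

lemma measure_Int_squares_le:
  assumes "0 \<le> \<delta>"
  shows "measure lborel (square w \<delta> \<inter> square w' \<delta>) \<le>
    \<delta>\<^sup>2 * of_bool (\<bar>fst w - fst w'\<bar> \<le> \<delta> \<and> \<bar>snd w - snd w'\<bar> \<le> \<delta>)"
proof (cases "square w \<delta> \<inter> square w' \<delta> = {}")
  case False
  have "measure lborel (square w \<delta> \<inter> square w' \<delta>) \<le> measure lborel (square w \<delta>)"
    by (intro measure_mono_fmeasurable fmeasurableD) auto
  then show ?thesis
    using squares_intersect_imp_close[OF False] assms by (simp add: measure_square)
qed simp

text \<open>
  The second moment method for the squares of side \<open>\<delta>\<close> with corners \<open>g - z\<close>, where \<open>g\<close> is a corner of \<open>K\<^sub>n\<close> and \<open>z\<close> a
  sample point of the graph. The sum of their areas is at least \<open>(B - A) / 3\<close>, independently of \<open>n\<close>, and the areas of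
  their pairwise intersections add up to at most a multiple of \<open>n\<close>.
\<close>
lemma difference_measure_lower_bound:
  assumes h: "curved_graph h h' A B M c" and S: "\<And>x. x \<in> {A..B} \<Longrightarrow> (x, h x) \<in> S" and n: "n \<ge> 1"
    and D: "{p - z | p z. p \<in> four_corner_cantor n \<and> z \<in> S} \<in> sets borel"
  shows "ennreal (((B - A) / 3)\<^sup>2 /
      ((B - A) / 3 + 1 + 2 * (2 * (1 + M)\<^sup>2 / c + (1 + M) * (B - A) + 2)) * inverse (real n)) \<le>
    emeasure lborel {p - z | p z. p \<in> four_corner_cantor n \<and> z \<in> S}"
proof -
  let ?D = "{p - z | p z. p \<in> four_corner_cantor n \<and> z \<in> S}"
  define \<delta> :: real where "\<delta> = 1 / 4 ^ n"
  define C where "C = 2 * (1 + M)\<^sup>2 / c + (1 + M) * (B - A) + 2"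
  have AB: "A < B" and C: "0 \<le> C"
    using h by (auto simp: curved_graph_def C_def)
  have \<delta>: "0 < \<delta>" "4 ^ n * \<delta> = 1" "16 ^ n * \<delta>\<^sup>2 = 1"
    by (simp_all add: \<delta>_def power2_eq_square flip: power_mult_distrib)
  \<comment> \<open>The number of points of the grid of step \<open>3 * \<delta>\<close> that fit into \<open>{A..B}\<close>.\<close>
  define N where "N = nat \<lfloor>(B - A) / (3 * \<delta>)\<rfloor> + 1"
  have N_floor: "real N = of_int \<lfloor>(B - A) / (3 * \<delta>)\<rfloor> + 1"
    using AB \<delta> by (simp add: N_def)
  have N_ge: "(B - A) / 3 \<le> real N * \<delta>"
  proof -
    have "(B - A) / (3 * \<delta>) \<le> real N"
      unfolding N_floor by linarith
    then show ?thesis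
      using \<delta>(1) by (simp add: field_simps)
  qed
  have N_le: "real N * \<delta> \<le> (B - A) / 3 + 1"
  proof -
    have "real N \<le> (B - A) / (3 * \<delta>) + 1"
      unfolding N_floor by linarith
    then have "real N * \<delta> \<le> (B - A) / 3 + \<delta>"
      using \<delta>(1) by (simp add: field_simps)
    also have "\<delta> \<le> 1"
      by (simp add: \<delta>_def)
    finally show ?thesis
      by simp
  qed
  define x where "x i = A + 3 * \<delta> * real i" for i
  have x_le: "x i \<le> B" if "i < N" for i
  proof -
    have "real i \<le> of_int \<lfloor>(B - A) / (3 * \<delta>)\<rfloor>"
      using that N_floor by linarith
    also have "\<dots> \<le> (B - A) / (3 * \<delta>)"
      by simp
    finally show ?thesis
      using \<delta>(1) by (simp add: x_def field_simps)
  qed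
  have x_mem: "x i \<in> {A..B}" if "i < N" for i
    using x_le[OF that] \<delta>(1) by (simp add: x_def)
  define Q where "Q = (\<lambda>(g, i). square (g - (x i, h (x i))) \<delta>)"
  define J where "J = corners n \<times> {..<N}"
  define U where "U = (\<Union>k\<in>J. Q k)"
  have fin: "finite J"
    by (simp add: J_def finite_corners)
  have Q_meas: "Q k \<in> fmeasurable lborel" "measure lborel (Q k) = \<delta>\<^sup>2" for k
    using \<delta>(1) by (simp_all add: Q_def case_prod_beta measure_square)
  have first: "(\<Sum>k\<in>J. measure lborel (Q k)) = real N * \<delta>"
  proof -
    have "(\<Sum>k\<in>J. measure lborel (Q k)) = (4 ^ n * \<delta>) * (real N * \<delta>)"
      by (simp add: Q_meas J_def card_cartesian_product card_corners power2_eq_square)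
    then show ?thesis
      by (simp add: \<delta>)
  qed
  have second: "(\<Sum>k\<in>J. \<Sum>l\<in>J. measure lborel (Q k \<inter> Q l)) \<le> ((B - A) / 3 + 1 + 2 * C) * real n"
  proof -
    let ?near = "\<lambda>g i g' j. of_bool (\<bar>x j - x i - fst (g' - g)\<bar> \<le> \<delta> \<and>
      \<bar>h (x j) - h (x i) - snd (g' - g)\<bar> \<le> \<delta>) :: real"
    have "(\<Sum>k\<in>J. \<Sum>l\<in>J. measure lborel (Q k \<inter> Q l)) \<le>
        (\<Sum>k\<in>J. \<Sum>l\<in>J. \<delta>\<^sup>2 * ?near (fst k) (snd k) (fst l) (snd l))"
    proof (intro sum_mono)
      fix k l
      show "measure lborel (Q k \<inter> Q l) \<le> \<delta>\<^sup>2 * ?near (fst k) (snd k) (fst l) (snd l)"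
        using measure_Int_squares_le[of \<delta> "fst k - (x (snd k), h (x (snd k)))"
            "fst l - (x (snd l), h (x (snd l)))"] \<delta>(1)
        by (simp add: Q_def case_prod_beta algebra_simps)
    qed
    also have "\<dots> = (\<Sum>g\<in>corners n. \<Sum>i<N. \<Sum>g'\<in>corners n. \<Sum>j<N. \<delta>\<^sup>2 * ?near g i g' j)"
    proof -
      have "(\<Sum>k\<in>J. F k) = (\<Sum>g\<in>corners n. \<Sum>i<N. F (g, i))" for F :: "(real \<times> real) \<times> nat \<Rightarrow> real"
        by (simp add: J_def sum.cartesian_product)
      then show ?thesis
        by (simp only: fst_conv snd_conv)
    qed
    also have "\<dots> = (\<Sum>g\<in>corners n. \<Sum>g'\<in>corners n. \<Sum>i<N. \<Sum>j<N. \<delta>\<^sup>2 * ?near g i g' j)"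
      by (intro sum.cong refl sum.swap)
    also have "\<dots> = \<delta>\<^sup>2 * (\<Sum>g\<in>corners n. \<Sum>g'\<in>corners n. real (card (grid_chords h A \<delta> N (g' - g))))"
    proof -
      have "(\<Sum>i<N. \<Sum>j<N. ?near g i g' j) = real (card (grid_chords h A \<delta> N (g' - g)))" for g g'
      proof -
        have "(\<Sum>i<N. \<Sum>j<N. ?near g i g' j) = (\<Sum>(i, j)\<in>{..<N} \<times> {..<N}. ?near g i g' j)"
          by (rule sum.cartesian_product)
        also have "\<dots> = (\<Sum>r\<in>{..<N} \<times> {..<N}. of_bool (r \<in> grid_chords h A \<delta> N (g' - g)))"
          by (intro sum.cong) (auto simp: grid_chords_def x_def)
        also have "\<dots> = real (card (({..<N} \<times> {..<N}) \<inter> grid_chords h A \<delta> N (g' - g)))"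
          by (simp add: sum_of_bool_eq)
        also have "({..<N} \<times> {..<N}) \<inter> grid_chords h A \<delta> N (g' - g) = grid_chords h A \<delta> N (g' - g)"
          by (auto simp: grid_chords_def)
        finally show ?thesis .
      qed
      then show ?thesis
        by (simp only: flip: sum_distrib_left)
    qed
    also have "\<dots> \<le> \<delta>\<^sup>2 * (4 ^ n * real N + C * (2 * real n * 16 ^ n))"
      using chord_energy_le[OF h, of N n] x_le unfolding C_def x_def \<delta>_def
      by (intro mult_left_mono) auto
    also have "\<dots> = (4 ^ n * \<delta>) * (real N * \<delta>) + (16 ^ n * \<delta>\<^sup>2) * (2 * C * real n)"
      by (simp add: algebra_simps power2_eq_square)
    also have "\<dots> \<le> ((B - A) / 3 + 1) * 1 + 2 * C * real n"
      using N_le by (simp add: \<delta>)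
    also have "\<dots> \<le> ((B - A) / 3 + 1) * real n + 2 * C * real n"
      using n AB by (intro add_right_mono mult_left_mono) auto
    finally show ?thesis
      by (simp add: algebra_simps)
  qed
  have K: "0 < (B - A) / 3 + 1 + 2 * C"
    using AB C by (intro add_pos_nonneg) auto
  have "((B - A) / 3)\<^sup>2 \<le> (real N * \<delta>)\<^sup>2"
    using N_ge AB by (intro power_mono) auto
  also have "\<dots> \<le> measure lborel U * (\<Sum>k\<in>J. \<Sum>l\<in>J. measure lborel (Q k \<inter> Q l))"
    using second_moment_lower_bound[OF fin, of Q lborel] Q_meas unfolding first U_def by simp
  also have "\<dots> \<le> measure lborel U * (((B - A) / 3 + 1 + 2 * C) * real n)"
    by (intro mult_left_mono second) auto
  finally have "((B - A) / 3)\<^sup>2 / (((B - A) / 3 + 1 + 2 * C) * real n) \<le> measure lborel U"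
    by (rule iffD2[OF pos_divide_le_eq, rotated]) (rule mult_pos_pos, use K n in simp_all)
  then have U_ge: "((B - A) / 3)\<^sup>2 / ((B - A) / 3 + 1 + 2 * C) * inverse (real n) \<le> measure lborel U"
    by (simp only: divide_inverse inverse_mult_distrib mult.assoc)
  have "U \<in> fmeasurable lborel"
    unfolding U_def by (intro fmeasurable.finite_UN fin Q_meas)
  then have "emeasure lborel U = ennreal (measure lborel U)"
    by (rule emeasure_eq_measure2)
  then have "ennreal (((B - A) / 3)\<^sup>2 / ((B - A) / 3 + 1 + 2 * C) * inverse (real n)) \<le> emeasure lborel U"
    using U_ge by (simp add: ennreal_leI)
  also have "\<dots> \<le> emeasure lborel ?D"
  proof (intro emeasure_mono)
    show "U \<subseteq> ?D"
    proof
      fix w assume "w \<in> U"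
      then obtain g i where g: "g \<in> corners n" and i: "i < N"
        and w: "w \<in> square (g - (x i, h (x i))) \<delta>"
        by (auto simp: U_def J_def Q_def)
      have "w + (x i, h (x i)) \<in> cbox g (g + (\<delta>, \<delta>))"
        using w by (cases g; cases w) (auto simp: square_def cbox_Pair_eq)
      then have "w + (x i, h (x i)) \<in> four_corner_cantor n"
        using corner_square_subset[OF g] by (auto simp: \<delta>_def)
      moreover have "(x i, h (x i)) \<in> S"
        using S x_mem[OF i] by blast
      moreover have "w = (w + (x i, h (x i))) - (x i, h (x i))"
        by simp
      ultimately show "w \<in> ?D"
        by blast
    qed
  qed (use D in simp)
  finally show ?thesis
    by (simp add: C_def)
qed

theorem theorem5:
  fixes S :: "(real \<times> real) set"
  assumes "curve S"
    and "piecewise_C1_bilipschitz_tangent S"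
  shows "\<exists>c::real. c > 0 \<and>
    (\<forall>n::nat. n \<ge> 1 \<longrightarrow> favard_curve_length S (four_corner_cantor n) \<ge> ennreal (c * inverse (real n)))"
proof -
  obtain I \<gamma> where I: "nondegenerate_interval I" and \<gamma>: "continuous_on I \<gamma>" "S = \<gamma> ` I"
    using assms(1) by (auto simp: curve_def)
  then have "S \<noteq> {}" "is_interval I"
    using interior_subset by (force simp: nondegenerate_interval_def)+
  obtain F where F: "partition_on S F" "\<And>P. P \<in> F \<Longrightarrow> C1_bilipschitz_tangent_arc P"
    using assms(2) by (auto simp: piecewise_C1_bilipschitz_tangent_def)
  then obtain P where P: "P \<in> F" "P \<subseteq> S"
    using \<open>S \<noteq> {}\<close> by (auto simp: partition_on_def)
  then obtain h h' A B M c where h: "curved_graph h h' A B M c" "\<And>x. x \<in> {A..B} \<Longrightarrow> (x, h x) \<in> S"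
    using arc_contains_curved_graph F(2) by (meson subsetD)
  have D: "{p - z | p z. p \<in> four_corner_cantor n \<and> z \<in> S} \<in> sets borel" for n
    using borel_compact_minus_curve[OF compact_four_corner_cantor \<open>is_interval I\<close> \<gamma>] .
  define K where "K = ((B - A) / 3)\<^sup>2 /
      ((B - A) / 3 + 1 + 2 * (2 * (1 + M)\<^sup>2 / c + (1 + M) * (B - A) + 2))"
  have "0 < K"
    using h(1) unfolding K_def curved_graph_def
    by (intro divide_pos_pos add_pos_nonneg) auto
  moreover have "ennreal (K * inverse (real n)) \<le> favard_curve_length S (four_corner_cantor n)"
    if "n \<ge> 1" for n
    using difference_measure_lower_bound[OF h that D] D
    by (simp add: favard_curve_length_eq_difference K_def)
  ultimately show ?thesis
    by blast
qed

end
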